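(* A minimal generating set of $ESL_5(\mathbb{Z})$ is $\{M_{10},t_{12}\}$, where $$t_{12}=\begin{pmatrix}1&1&0&0&0\\0&1&0&0&0\\0&0&1&0&0\\0&0&0&1&0\\0&0&0&0&1\end{pmatrix},\qquad M_{10}=\begin{pmatrix}0&0&0&0&-1\\1&0&0&0&0\\0&1&0&0&0\\0&0&1&0&0\\0&0&0&1&0\end{pmatrix}.$$
   Context: $ESL_5(\mathbb{Z})$ denotes the group of all $5\times 5$ integer matrices with determinant $1$ or $-1$. A generating set is minimal if no generating set of smaller cardinality exists. *)

theory Defs
  imports
    "Jordan_Normal_Form.Determinant"
    "HOL-Algebra.Generated_Groups"
    "HOL-Library.Equipollence"
begin

definition ESL :: "nat \<Rightarrow> int mat monoid" where
  "ESL n = \<lparr>carrier = {A \<in> carrier_mat n n. det A = 1 \<or> det A = -1},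
     mult = (\<lambda>A B. A * B), one = 1\<^sub>m n\<rparr>"

lemma group_ESL: "group (ESL n)"
proof (rule groupI)
  fix A assume A: "A \<in> carrier (ESL n)"
  then have Ac: "A \<in> carrier_mat n n" and dA: "det A = 1 \<or> det A = -1"
    by (auto simp: ESL_def)
  define B where "B = det A \<cdot>\<^sub>m adj_mat A"
  have adjc: "adj_mat A \<in> carrier_mat n n"
    and adj: "adj_mat A * A = det A \<cdot>\<^sub>m 1\<^sub>m n"
    using adj_mat[OF Ac] by auto
  have Bc: "B \<in> carrier_mat n n" using adjc by (simp add: B_def)
  have "B * A = det A \<cdot>\<^sub>m (det A \<cdot>\<^sub>m 1\<^sub>m n)"
    unfolding B_def mult_smult_assoc_mat[OF adjc Ac] adj by (rule refl)
  also have "\<dots> = 1\<^sub>m n"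
    using dA by (intro eq_matI) auto
  finally have BA: "B * A = 1\<^sub>m n" .
  then have "det B * det A = 1"
    using det_mult[OF Bc Ac] by simp
  then have "det B = 1 \<or> det B = -1"
    using dA by auto
  then show "\<exists>y\<in>carrier (ESL n). y \<otimes>\<^bsub>ESL n\<^esub> A = \<one>\<^bsub>ESL n\<^esub>"
    using Bc BA by (intro bexI[of _ B]) (auto simp: ESL_def)
qed (auto simp: ESL_def det_mult)

definition generating_set :: "('a, 'b) monoid_scheme \<Rightarrow> 'a set \<Rightarrow> bool" where
  "generating_set G S \<longleftrightarrow> S \<subseteq> carrier G \<and> generate G S = carrier G"

text \<open>Minimality refers to cardinality, not to inclusion.  Comparing with \<open>\<prec>\<close>
  rather than \<open>card\<close> treats infinite generating sets correctly.\<close>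

definition minimal_generating_set :: "('a, 'b) monoid_scheme \<Rightarrow> 'a set \<Rightarrow> bool" where
  "minimal_generating_set G S \<longleftrightarrow>
     generating_set G S \<and> \<not> (\<exists>T. generating_set G T \<and> T \<prec> S)"

definition t12 :: "int mat" where
  "t12 = mat_of_rows_list 5
    [[1, 1, 0, 0, 0],
     [0, 1, 0, 0, 0],
     [0, 0, 1, 0, 0],
     [0, 0, 0, 1, 0],
     [0, 0, 0, 0, 1]]"

definition M10 :: "int mat" where
  "M10 = mat_of_rows_list 5
    [[0, 0, 0, 0, -1],
     [1, 0, 0, 0, 0],
     [0, 1, 0, 0, 0],
     [0, 0, 1, 0, 0],
     [0, 0, 0, 1, 0]]"

end

theory Submission imports Defs begin

text \<open>
  Write \<open>E k l\<close> for the elementary matrix \<open>addrow_mat n 1 k l\<close>, the identity with an extra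
  \<open>1\<close> at position \<open>(k, l)\<close>; the matrix \<open>t12\<close> is \<open>E 0 1\<close>.

  The matrix \<open>M10\<close> permutes the basis vectors cyclically up to a sign, so conjugation by it turns
  \<open>E 0 1\<close> into \<open>E 1 2\<close>, \<open>E 2 3\<close>, \<open>E 3 4\<close> and finally the inverse of \<open>E 4 0\<close>
  (\<open>M10_shift\<close>, \<open>M10_wrap\<close>). The commutator of \<open>E k l\<close> and \<open>E l m\<close> is \<open>E k m\<close>
  (\<open>addrow_mat_commutator\<close>), so the set of pairs \<open>(k, l)\<close> with \<open>E k l\<close> in the generated
  subgroup is transitive off the diagonal; since it contains a cycle through all five indices, it
  contains every pair of distinct indices (\<open>elementary_in_subgroup\<close>).

  The Euclidean algorithm, carried out by row operations, writes every integer matrix of determinant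
  \<open>1\<close> as a product of elementary matrices (\<open>det_one_in_subgroup_if_elementary\<close>). The matrices of
  determinant \<open>-1\<close> follow from these because \<open>M10 ^ 5\<close> is the negative of the identity, which has
  determinant \<open>-1\<close> in odd dimension.

  A generating set of smaller cardinality would have at most one element, so the group would be
  cyclic and hence abelian; but \<open>M10\<close> and \<open>t12\<close> do not commute.
\<close>

section \<open>Elementary matrices in a subgroup\<close>

lemma carrier_ESL_iff: "A \<in> carrier (ESL n) \<longleftrightarrow> A \<in> carrier_mat n n \<and> (det A = 1 \<or> det A = -1)"
  by (simp add: ESL_def)

lemma mult_ESL [simp]: "A \<otimes>\<^bsub>ESL n\<^esub> B = A * B"
  by (simp add: ESL_def)

lemma one_ESL [simp]: "\<one>\<^bsub>ESL n\<^esub> = 1\<^sub>m n"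
  by (simp add: ESL_def)

lemma addrow_mat_in_ESL:
  assumes "k < n" "k \<noteq> l"
  shows "addrow_mat n a k l \<in> carrier (ESL n)"
  using assms det_addrow_mat[of k l n a] by (simp add: carrier_ESL_iff)

lemma subgroup_cancel_left:
  assumes H: "subgroup H (ESL n)" and T: "T \<in> H" and A: "A \<in> carrier (ESL n)" and TA: "T * A \<in> H"
  shows "A \<in> H"
proof -
  interpret group "ESL n" by (rule group_ESL)
  interpret subgroup H "ESL n" by (rule H)
  have "inv\<^bsub>ESL n\<^esub> T \<otimes>\<^bsub>ESL n\<^esub> (T \<otimes>\<^bsub>ESL n\<^esub> A) \<in> H"
    using subgroup.m_closed[OF H subgroup.m_inv_closed[OF H T] TA] by simp
  moreover have "inv\<^bsub>ESL n\<^esub> T \<otimes>\<^bsub>ESL n\<^esub> (T \<otimes>\<^bsub>ESL n\<^esub> A) = A"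
    using T A by (metis inv_closed l_inv l_one m_assoc mem_carrier)
  ultimately show ?thesis by simp
qed

lemma subgroup_cancel_right:
  assumes H: "subgroup H (ESL n)" and T: "T \<in> H" and A: "A \<in> carrier (ESL n)" and AT: "A * T \<in> H"
  shows "A \<in> H"
proof -
  interpret group "ESL n" by (rule group_ESL)
  interpret subgroup H "ESL n" by (rule H)
  have "(A \<otimes>\<^bsub>ESL n\<^esub> T) \<otimes>\<^bsub>ESL n\<^esub> inv\<^bsub>ESL n\<^esub> T \<in> H"
    using subgroup.m_closed[OF H AT subgroup.m_inv_closed[OF H T]] by simp
  moreover have "(A \<otimes>\<^bsub>ESL n\<^esub> T) \<otimes>\<^bsub>ESL n\<^esub> inv\<^bsub>ESL n\<^esub> T = A"
    using T A by (metis inv_closed m_assoc mem_carrier r_inv r_one)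
  ultimately show ?thesis by simp
qed

lemma addrow_mat_mult_same:
  fixes a b :: "'a :: comm_ring_1"
  assumes "k < n" "l < n" "k \<noteq> l"
  shows "addrow_mat n a k l * addrow_mat n b k l = addrow_mat n (a + b) k l"
  unfolding addrow_mat[OF addrow_mat_carrier assms(2), symmetric]
  using assms by (intro eq_matI) auto

lemma addrow_mat_multiples_in_subgroup:
  assumes H: "subgroup H (ESL n)" and kl: "k < n" "l < n" "k \<noteq> l"
    and one: "addrow_mat n 1 k l \<in> H"
  shows "addrow_mat n a k l \<in> H"
proof (induction a rule: int_induct[where k = 0])
  case base
  have "addrow_mat n (0::int) k l = 1\<^sub>m n"
    by (intro eq_matI) auto
  then show ?case
    using subgroup.one_closed[OF H] by simp
next
  case (step1 i)
  then show ?case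
    using subgroup.m_closed[OF H step1(2) one] addrow_mat_mult_same[OF kl, of i 1] by simp
next
  case (step2 i)
  have "addrow_mat n (i - 1) k l * addrow_mat n 1 k l \<in> H"
    using step2 addrow_mat_mult_same[OF kl, of "i - 1" 1] by simp
  then show ?case
    using subgroup_cancel_right[OF H one] addrow_mat_in_ESL[OF kl(1,3)] by blast
qed

text \<open>The relation that makes membership of elementary matrices in a subgroup transitive. It is the
  commutator identity cleared of inverses, so that both sides can be computed as successive row
  operations.\<close>

lemma addrow_mat_commutator:
  fixes a b :: "'a :: comm_ring_1"
  assumes "k < n" "l < n" "m < n" "k \<noteq> l" "l \<noteq> m" "k \<noteq> m"
  shows "addrow_mat n (a * b) k m * (addrow_mat n b l m * addrow_mat n a k l) =
         addrow_mat n a k l * addrow_mat n b l m"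
  unfolding addrow_mat[OF addrow_mat_carrier assms(2), symmetric]
    addrow_mat[OF addrow_mat_carrier assms(3), symmetric]
  using assms
  by (subst addrow_mat[symmetric, where nc = n]) (auto intro!: eq_matI simp: algebra_simps)

lemma addrow_mat_trans_in_subgroup:
  assumes H: "subgroup H (ESL n)"
    and klm: "k < n" "l < n" "m < n" "k \<noteq> l" "l \<noteq> m" "k \<noteq> m"
    and kl: "addrow_mat n 1 k l \<in> H" and lm: "addrow_mat n 1 l m \<in> H"
  shows "addrow_mat n 1 k m \<in> H"
proof (rule subgroup_cancel_right[OF H])
  show "addrow_mat n 1 l m * addrow_mat n 1 k l \<in> H"
    using subgroup.m_closed[OF H lm kl] by simp
  show "addrow_mat n 1 k m \<in> carrier (ESL n)"
    using klm by (intro addrow_mat_in_ESL)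
  show "addrow_mat n 1 k m * (addrow_mat n 1 l m * addrow_mat n 1 k l) \<in> H"
    using subgroup.m_closed[OF H kl lm] addrow_mat_commutator[OF klm, of "1::int" 1] by simp
qed

section \<open>Integer row reduction\<close>

definition unit_columns :: "nat \<Rightarrow> 'a :: {zero, one} mat \<Rightarrow> bool" where
  "unit_columns k A \<longleftrightarrow> (\<forall>i < dim_row A. \<forall>j < k. A $$ (i, j) = (if i = j then 1 else 0))"

lemma unit_columns_addrow:
  fixes A :: "'a :: comm_ring_1 mat"
  assumes "A \<in> carrier_mat n n" "unit_columns k A" "k \<le> q" "q < n"
  shows "unit_columns k (addrow a p q A)"
  using assms by (auto simp: unit_columns_def)

lemma addrow_in_ESL:
  assumes A: "A \<in> carrier (ESL n)" and pq: "p < n" "q < n" "p \<noteq> q"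
  shows "addrow a p q A \<in> carrier (ESL n)"
  using A det_addrow[OF pq(2,3), of A a] by (auto simp: carrier_ESL_iff)

lemma subgroup_mem_if_addrow_mem:
  assumes H: "subgroup H (ESL n)"
    and el: "\<And>k l. k < n \<Longrightarrow> l < n \<Longrightarrow> k \<noteq> l \<Longrightarrow> addrow_mat n 1 k l \<in> H"
    and A: "A \<in> carrier (ESL n)" and pq: "p < n" "q < n" "p \<noteq> q"
    and mem: "addrow a p q A \<in> H"
  shows "A \<in> H"
proof (rule subgroup_cancel_left[OF H _ A])
  show "addrow_mat n a p q \<in> H"
    using addrow_mat_multiples_in_subgroup[OF H pq el[OF pq]] .
  show "addrow_mat n a p q * A \<in> H"
    using mem A pq addrow_mat[of A n n q a p] by (simp add: carrier_ESL_iff)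
qed

text \<open>The row \<open>k\<close> of the inverse of \<open>A\<close> is a Bezout relation for the column \<open>k\<close> of \<open>A\<close>. As \<open>A\<close> fixes
  the first \<open>k\<close> basis vectors, so does its inverse, and hence the first \<open>k\<close> coefficients of that
  relation vanish. The entries on and below the diagonal therefore generate the unit ideal on their
  own, which is what the Euclidean algorithm needs: it must not use the rows above, since adding
  those would destroy the columns already reduced.\<close>

lemma unimodular_column:
  assumes A: "A \<in> carrier (ESL n)" and uc: "unit_columns k A" and k: "k < n"
  shows "\<exists>b. (\<Sum>i\<in>{k..<n}. b i * A $$ (i, k)) = 1"
proof -
  interpret group "ESL n" by (rule group_ESL)
  define B where "B = inv\<^bsub>ESL n\<^esub> A"
  have Ac: "A \<in> carrier_mat n n" using A by (simp add: carrier_ESL_iff)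
  have Bc: "B \<in> carrier_mat n n" using inv_closed[OF A] by (simp add: B_def carrier_ESL_iff)
  have BA: "B * A = 1\<^sub>m n" using l_inv[OF A] by (simp add: B_def)
  have entry: "(\<Sum>i\<in>{0..<n}. B $$ (k, i) * A $$ (i, j)) = (if k = j then 1 else 0)" if "j < n" for j
  proof -
    have "(B * A) $$ (k, j) = (\<Sum>i\<in>{0..<n}. B $$ (k, i) * A $$ (i, j))"
      using Ac Bc k that by (simp add: scalar_prod_def)
    then show ?thesis using BA k that by simp
  qed
  have zero: "B $$ (k, j) = 0" if "j < k" for j
  proof -
    have "(\<Sum>i\<in>{0..<n}. B $$ (k, i) * A $$ (i, j)) = (\<Sum>i\<in>{0..<n}. if i = j then B $$ (k, i) else 0)"
      using uc Ac that by (intro sum.cong) (auto simp: unit_columns_def)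
    then show ?thesis using entry[of j] that k by simp
  qed
  have "(\<Sum>i\<in>{k..<n}. B $$ (k, i) * A $$ (i, k)) = (\<Sum>i\<in>{0..<n}. B $$ (k, i) * A $$ (i, k))"
    using zero by (intro sum.mono_neutral_left) auto
  then show ?thesis using entry[OF k] by (intro exI[of _ "\<lambda>i. B $$ (k, i)"]) simp
qed

text \<open>A pivot equal to \<open>1\<close> clears its column, one row at a time. Because row \<open>k\<close> vanishes in the
  columns before \<open>k\<close>, adding multiples of it also to the rows above does no harm. Here and
  below, \<open>next_col\<close> is the induction hypothesis of the reduction over columns.\<close>

lemma mem_subgroup_if_pivot_one:
  assumes H: "subgroup H (ESL n)"
    and el: "\<And>k l. k < n \<Longrightarrow> l < n \<Longrightarrow> k \<noteq> l \<Longrightarrow> addrow_mat n 1 k l \<in> H"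
    and k: "k < n"
    and next_col: "\<And>A. A \<in> carrier (ESL n) \<Longrightarrow> det A = 1 \<Longrightarrow> unit_columns (Suc k) A \<Longrightarrow> A \<in> H"
    and A: "A \<in> carrier (ESL n)" "det A = 1" "unit_columns k A" "A $$ (k, k) = 1"
  shows "A \<in> H"
  using A
proof (induction "card {i. i < n \<and> i \<noteq> k \<and> A $$ (i, k) \<noteq> 0}" arbitrary: A rule: less_induct)
  case (less A)
  have Ac: "A \<in> carrier_mat n n" using less.prems by (simp add: carrier_ESL_iff)
  show ?case
  proof (cases "\<exists>i<n. i \<noteq> k \<and> A $$ (i, k) \<noteq> 0")
    case False
    then have "unit_columns (Suc k) A"
      using less.prems Ac by (auto simp: unit_columns_def less_Suc_eq)
    then show ?thesis using next_col less.prems by blast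
  next
    case True
    then obtain p where p: "p < n" "p \<noteq> k" "A $$ (p, k) \<noteq> 0" by blast
    define A' where "A' = addrow (- A $$ (p, k)) p k A"
    have entries: "A' $$ (i, k) = (if i = p then 0 else A $$ (i, k))" if "i < n" for i
      using that k Ac less.prems(4) by (simp add: A'_def)
    have drop: "{i. i < n \<and> i \<noteq> k \<and> A' $$ (i, k) \<noteq> 0} = {i. i < n \<and> i \<noteq> k \<and> A $$ (i, k) \<noteq> 0} - {p}"
      by (auto simp: entries split: if_splits)
    have fewer: "card {i. i < n \<and> i \<noteq> k \<and> A' $$ (i, k) \<noteq> 0} <
        card {i. i < n \<and> i \<noteq> k \<and> A $$ (i, k) \<noteq> 0}"
      unfolding drop by (rule card_Diff1_less) (use p in auto)
    have "A' \<in> H"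
    proof (rule less.hyps[OF fewer])
      show "A' \<in> carrier (ESL n)"
        using p k less.prems unfolding A'_def by (intro addrow_in_ESL) auto
      show "det A' = 1"
        using p k less.prems(2) det_addrow[OF k p(2) Ac] by (simp add: A'_def)
      show "unit_columns k A'"
        using k less.prems(3) Ac unfolding A'_def by (intro unit_columns_addrow) auto
      show "A' $$ (k, k) = 1"
        using entries[OF k] p less.prems(4) by simp
    qed
    then show ?thesis
      using subgroup_mem_if_addrow_mem[OF H el less.prems(1) p(1) k p(2)] by (simp add: A'_def)
  qed
qed

lemma abs_diff_sgn_less:
  fixes x y :: int
  assumes "x \<noteq> 0" "y \<noteq> 0" "\<bar>x\<bar> \<le> \<bar>y\<bar>"
  shows "\<bar>- (sgn x * sgn y) * x + y\<bar> < \<bar>y\<bar>"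
  using assms by (auto simp: sgn_if abs_if split: if_splits)

text \<open>The Euclidean algorithm on the entries of column \<open>k\<close> on and below the diagonal, measured by the
  sum of their absolute values. As long as two of them are nonzero, adding or subtracting the row
  of the smaller one brings the larger one closer to zero. When only one is left it is a unit, by
  \<open>unimodular_column\<close>. Moving it to the diagonal and correcting its sign with elementary matrices
  alone takes a second row, whence \<open>Suc k < n\<close>.\<close>

lemma mem_subgroup_if_unit_columns_step:
  assumes H: "subgroup H (ESL n)"
    and el: "\<And>k l. k < n \<Longrightarrow> l < n \<Longrightarrow> k \<noteq> l \<Longrightarrow> addrow_mat n 1 k l \<in> H"
    and k: "Suc k < n"
    and next_col: "\<And>A. A \<in> carrier (ESL n) \<Longrightarrow> det A = 1 \<Longrightarrow> unit_columns (Suc k) A \<Longrightarrow> A \<in> H"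
    and A: "A \<in> carrier (ESL n)" "det A = 1" "unit_columns k A"
  shows "A \<in> H"
  using A
proof (induction "\<Sum>i\<in>{k..<n}. nat \<bar>A $$ (i, k)\<bar>" arbitrary: A rule: less_induct)
  case (less A)
  have Ac: "A \<in> carrier_mat n n" using less.prems by (simp add: carrier_ESL_iff)
  have addrow_pres: "addrow a p q B \<in> carrier (ESL n)" "det (addrow a p q B) = 1"
    "unit_columns k (addrow a p q B)"
    if "B \<in> carrier (ESL n)" "det B = 1" "unit_columns k B" "p < n" "q < n" "p \<noteq> q" "k \<le> q" for a p q B
    using that addrow_in_ESL[of B n p q a] det_addrow[of q n p B a] unit_columns_addrow[of B n k q a p]
    by (auto simp: carrier_ESL_iff)
  note lift = subgroup_mem_if_addrow_mem[OF H el]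
  note pivot = mem_subgroup_if_pivot_one[OF H el _ next_col]
  have kn: "k < n" using k by simp
  show ?case
  proof (cases "\<exists>p q. p \<in> {k..<n} \<and> q \<in> {k..<n} \<and> p \<noteq> q \<and> A $$ (p, k) \<noteq> 0 \<and> A $$ (q, k) \<noteq> 0")
    case True
    then obtain p q where pq: "k \<le> p" "p < n" "k \<le> q" "q < n" "p \<noteq> q"
        "A $$ (p, k) \<noteq> 0" "A $$ (q, k) \<noteq> 0" "\<bar>A $$ (q, k)\<bar> \<le> \<bar>A $$ (p, k)\<bar>"
      by (metis atLeastLessThan_iff linear)
    define a where "a = - (sgn (A $$ (q, k)) * sgn (A $$ (p, k)))"
    define A' where "A' = addrow a p q A"
    have entries: "A' $$ (i, k) = (if i = p then a * A $$ (q, k) + A $$ (p, k) else A $$ (i, k))"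
      if "i < n" for i
      using that kn Ac by (simp add: A'_def)
    have drop: "\<bar>A' $$ (p, k)\<bar> < \<bar>A $$ (p, k)\<bar>"
      using abs_diff_sgn_less[OF pq(7,6,8)] entries[OF pq(2)] by (simp add: a_def)
    have "A' \<in> H"
    proof (rule less.hyps)
      show "(\<Sum>i\<in>{k..<n}. nat \<bar>A' $$ (i, k)\<bar>) < (\<Sum>i\<in>{k..<n}. nat \<bar>A $$ (i, k)\<bar>)"
      proof (rule sum_strict_mono_ex1)
        show "\<forall>i\<in>{k..<n}. nat \<bar>A' $$ (i, k)\<bar> \<le> nat \<bar>A $$ (i, k)\<bar>"
        proof
          fix i assume "i \<in> {k..<n}"
          then show "nat \<bar>A' $$ (i, k)\<bar> \<le> nat \<bar>A $$ (i, k)\<bar>"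
            using drop entries[of i] by (cases "i = p") auto
        qed
        show "\<exists>i\<in>{k..<n}. nat \<bar>A' $$ (i, k)\<bar> < nat \<bar>A $$ (i, k)\<bar>"
          using drop pq by (intro bexI[of _ p]) auto
      qed simp
    qed (use addrow_pres less.prems pq in \<open>auto simp: A'_def\<close>)
    then show ?thesis
      using lift[OF _ _ _ less.prems(1) pq(2,4,5)] by (simp add: A'_def)
  next
    case False
    obtain b where b: "(\<Sum>i\<in>{k..<n}. b i * A $$ (i, k)) = 1"
      using unimodular_column[OF less.prems(1,3) kn] by blast
    then obtain p where p: "p \<in> {k..<n}" "A $$ (p, k) \<noteq> 0"
      by (metis (no_types, lifting) mult_zero_right sum.neutral zero_neq_one)
    have zero: "A $$ (i, k) = 0" if "i \<in> {k..<n}" "i \<noteq> p" for i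
      using False p that by blast
    have "(\<Sum>i\<in>{k..<n}. b i * A $$ (i, k)) = b p * A $$ (p, k)"
      using p zero by (subst sum.remove[of _ p]) (auto intro!: sum.neutral)
    then have unit: "A $$ (p, k) = 1 \<or> A $$ (p, k) = -1"
      using b by (metis mult.commute pos_zmult_eq_1_iff_lemma)
    consider "p \<noteq> k" | "p = k" "A $$ (k, k) = 1" | "p = k" "A $$ (k, k) = -1"
      using unit by blast
    then show ?thesis
    proof cases
      case 1
      \<comment> \<open>The diagonal entry is \<open>0\<close>, and multiplying the unit in row \<open>p\<close> by itself gives \<open>1\<close>.\<close>
      define A' where "A' = addrow (A $$ (p, k)) k p A"
      have "A' \<in> H"
      proof (rule pivot)
        show "A' $$ (k, k) = 1"
          using 1 kn Ac unit zero[of k] by (auto simp: A'_def)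
      qed (use addrow_pres less.prems p 1 kn in \<open>auto simp: A'_def\<close>)
      then show ?thesis
        using lift[OF _ _ _ less.prems(1) kn, of p "A $$ (p, k)"] p 1 by (simp add: A'_def)
    next
      case 2
      then show ?thesis using pivot less.prems kn by blast
    next
      case 3
      \<comment> \<open>The entries in rows \<open>k\<close> and \<open>Suc k\<close> go from \<open>(-1, 0)\<close> to \<open>(-1, 1)\<close> and then to \<open>(1, 1)\<close>.\<close>
      define A1 where "A1 = addrow (-1) (Suc k) k A"
      define A2 where "A2 = addrow 2 k (Suc k) A1"
      have A1: "A1 \<in> carrier (ESL n)" "det A1 = 1" "unit_columns k A1"
        unfolding A1_def using addrow_pres less.prems k by auto
      have A2: "A2 \<in> carrier (ESL n)" "det A2 = 1" "unit_columns k A2"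
        unfolding A2_def using addrow_pres A1 k by auto
      have "A2 $$ (k, k) = 1"
        using 3 k Ac zero[of "Suc k"] by (simp add: A2_def A1_def)
      then have "A2 \<in> H" using pivot A2 kn by blast
      then have "A1 \<in> H"
        using lift[OF _ _ _ A1(1) kn k, of 2] by (simp add: A2_def)
      then show ?thesis
        using lift[OF _ _ _ less.prems(1) k kn, of "-1"] by (simp add: A1_def)
    qed
  qed
qed

text \<open>In the last column no second row is available to correct the sign of the pivot. There the matrix
  is upper triangular with all other diagonal entries \<open>1\<close>, so the pivot is the determinant.\<close>

lemma mem_subgroup_if_last_column:
  assumes H: "subgroup H (ESL n)"
    and el: "\<And>k l. k < n \<Longrightarrow> l < n \<Longrightarrow> k \<noteq> l \<Longrightarrow> addrow_mat n 1 k l \<in> H"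
    and n: "n = Suc k"
    and A: "A \<in> carrier (ESL n)" "det A = 1" "unit_columns k A"
  shows "A \<in> H"
proof -
  have Ac: "A \<in> carrier_mat n n" using A by (simp add: carrier_ESL_iff)
  have "upper_triangular A"
    using A(3) Ac n by (auto simp: unit_columns_def upper_triangular_def)
  then have "det A = prod_list (diag_mat A)"
    by (rule det_upper_triangular) (rule Ac)
  also have "diag_mat A = map (\<lambda>i. A $$ (i, i)) [0..<k] @ [A $$ (k, k)]"
    using Ac n by (simp add: diag_mat_def)
  also have "map (\<lambda>i. A $$ (i, i)) [0..<k] = map (\<lambda>i. 1) [0..<k]"
    using A(3) Ac n by (auto simp: unit_columns_def)
  finally have "A $$ (k, k) = 1"
    using A(2) by (simp add: map_replicate_const)
  moreover have "B \<in> H" if "B \<in> carrier (ESL n)" "unit_columns (Suc k) B" for B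
  proof -
    have "B = 1\<^sub>m n"
      using that n by (intro eq_matI) (auto simp: unit_columns_def carrier_ESL_iff)
    then show ?thesis using subgroup.one_closed[OF H] by simp
  qed
  ultimately show ?thesis
    using mem_subgroup_if_pivot_one[OF H el, of k A] n A by blast
qed

text \<open>Membership of a matrix with \<open>k\<close> reduced columns follows from that of the matrices with one more
  reduced column, so the induction descends from \<open>n - 1\<close> reduced columns to none.\<close>

theorem det_one_in_subgroup_if_elementary:
  assumes H: "subgroup H (ESL n)"
    and el: "\<And>k l. k < n \<Longrightarrow> l < n \<Longrightarrow> k \<noteq> l \<Longrightarrow> addrow_mat n 1 k l \<in> H"
    and n: "0 < n"
    and A: "A \<in> carrier_mat n n" "det A = 1"
  shows "A \<in> H"
proof -
  have "B \<in> H" if "k \<le> n - 1" "B \<in> carrier (ESL n)" "det B = 1" "unit_columns k B" for k B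
    using that
  proof (induction k arbitrary: B rule: inc_induct)
    case base
    then show ?case using mem_subgroup_if_last_column[OF H el, of "n - 1" B] n by auto
  next
    case (step k)
    then show ?case using mem_subgroup_if_unit_columns_step[OF H el, of k B] by auto
  qed
  from this[of 0 A] show ?thesis
    using A by (auto simp: carrier_ESL_iff unit_columns_def)
qed

section \<open>The two generators\<close>

lemma t12_eq: "t12 = addrow_mat 5 1 0 1"
  unfolding t12_def mat_of_rows_list_def
  by (intro eq_matI) (auto simp: less_Suc_eq numeral_eq_Suc)

lemma M10_eq: "M10 = mat 5 5 (\<lambda>(i, j). if i = Suc j then 1 else if i = 0 \<and> j = 4 then -1 else 0)"
  unfolding M10_def mat_of_rows_list_def
  by (intro eq_matI) (auto simp: less_Suc_eq numeral_eq_Suc)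

lemma M10_carrier: "M10 \<in> carrier_mat 5 5"
  by (simp add: M10_eq)

lemma M10_mult:
  assumes A: "dim_row A = 5"
  shows "M10 * A = mat 5 (dim_col A) (\<lambda>(i, j). if i = 0 then - A $$ (4, j) else A $$ (i - 1, j))"
proof (rule eq_matI; simp add: M10_carrier[THEN carrier_matD(1)] A)
  fix i j :: nat assume ij: "i < 5" "j < dim_col A"
  have "row M10 i \<bullet> col A j = (\<Sum>l\<in>{0..<5}. M10 $$ (i, l) * A $$ (l, j))"
    using ij A M10_carrier by (simp add: scalar_prod_def)
  also have "{0..<5::nat} = {0, 1, 2, 3, 4}" by auto
  finally show "(i = 0 \<longrightarrow> row M10 0 \<bullet> col A j = - A $$ (4, j)) \<and>
      (0 < i \<longrightarrow> row M10 i \<bullet> col A j = A $$ (i - Suc 0, j))"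
    using ij by (auto simp: M10_eq less_Suc_eq numeral_eq_Suc)
qed

lemma M10_pow5: "M10 * (M10 * (M10 * (M10 * M10))) = - 1\<^sub>m 5"
proof -
  \<comment> \<open>The trailing identity lets \<open>M10_mult\<close> act five times on a matrix with known entries.\<close>
  have "M10 * (M10 * (M10 * (M10 * (M10 * 1\<^sub>m 5)))) = - 1\<^sub>m 5"
    by (simp add: M10_mult) (intro eq_matI; auto simp: less_Suc_eq numeral_eq_Suc)
  then show ?thesis using M10_carrier by simp
qed

lemma uminus_mat_eq_smult: "- A = (-1 :: 'a :: ring_1) \<cdot>\<^sub>m A"
  by (intro eq_matI) auto

text \<open>The determinant is an integer whose fifth power is the determinant of \<open>M10 ^ 5\<close>, that is, \<open>-1\<close>.\<close>

lemma M10_in_ESL: "M10 \<in> carrier (ESL 5)"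
proof -
  have "det M10 ^ 5 = det (M10 * (M10 * (M10 * (M10 * M10))))"
    using M10_carrier by (simp add: det_mult[where n = 5] power_def numeral_eq_Suc)
  also have "\<dots> = -1"
    unfolding M10_pow5 by (simp add: uminus_mat_eq_smult)
  finally have "\<bar>det M10\<bar> ^ 5 = 1" by (simp flip: power_abs)
  then have "\<bar>det M10\<bar> = 1" using power_eq_imp_eq_base[of "\<bar>det M10\<bar>" 5 1] by simp
  then show ?thesis using M10_carrier by (auto simp: carrier_ESL_iff)
qed

lemma M10_shift:
  assumes "Suc k < 5" "Suc l < 5" "k \<noteq> l"
  shows "M10 * addrow_mat 5 a k l = addrow_mat 5 a (Suc k) (Suc l) * M10"
  using assms M10_carrier
  by (subst addrow_mat[symmetric, where nc = 5]; simp add: M10_mult)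
    (intro eq_matI; auto simp: M10_eq)

text \<open>The last basis vector goes to the negative of the first, so a sign appears when the column index
  wraps around.\<close>

lemma M10_wrap: "M10 * addrow_mat 5 a 3 4 = addrow_mat 5 (- a) 4 0 * M10"
  using M10_carrier
  by (subst addrow_mat[symmetric, where nc = 5]; simp add: M10_mult)
    (intro eq_matI; auto simp: M10_eq)

text \<open>Conjugation by \<open>M10\<close> gives the five pairs along the cycle \<open>0, 1, 2, 3, 4, 0\<close>, and commutators then
  give those at cyclic distance two, three and four.\<close>

lemma elementary_in_subgroup:
  assumes H: "subgroup H (ESL 5)" and M: "M10 \<in> H" and t: "t12 \<in> H"
    and kl: "k < 5" "l < 5" "k \<noteq> l"
  shows "addrow_mat 5 1 k l \<in> H"
proof -
  note mult = subgroup.m_closed[OF H, simplified]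
  have shift: "addrow_mat 5 1 (Suc k) (Suc (Suc k)) \<in> H"
    if "addrow_mat 5 1 k (Suc k) \<in> H" "k < 3" for k
  proof (rule subgroup_cancel_right[OF H M])
    show "addrow_mat 5 1 (Suc k) (Suc (Suc k)) * M10 \<in> H"
      using mult[OF M that(1)] M10_shift[of k "Suc k" 1] that(2) by simp
  qed (use that in \<open>auto intro: addrow_mat_in_ESL\<close>)
  have e01: "addrow_mat 5 1 0 1 \<in> H" using t by (simp add: t12_eq)
  have e12: "addrow_mat 5 1 1 2 \<in> H" using shift[of 0] e01 by (simp add: numeral_2_eq_2)
  have e23: "addrow_mat 5 1 2 3 \<in> H" using shift[of 1] e12 by (simp add: numeral_eq_Suc)
  have e34: "addrow_mat 5 1 3 4 \<in> H" using shift[of 2] e23 by (simp add: numeral_eq_Suc)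
  have e40: "addrow_mat 5 1 4 0 \<in> H"
  proof (rule subgroup_cancel_right[OF H M])
    show "addrow_mat 5 1 4 0 * M10 \<in> H"
      using mult[OF M addrow_mat_multiples_in_subgroup[OF H _ _ _ e34, of "-1"]] M10_wrap[of "-1"]
      by simp
  qed (auto intro: addrow_mat_in_ESL)
  note tr = addrow_mat_trans_in_subgroup[OF H]
  have e02: "addrow_mat 5 1 0 2 \<in> H" using tr[of 0 1 2] e01 e12 by simp
  have e13: "addrow_mat 5 1 1 3 \<in> H" using tr[of 1 2 3] e12 e23 by simp
  have e24: "addrow_mat 5 1 2 4 \<in> H" using tr[of 2 3 4] e23 e34 by simp
  have e30: "addrow_mat 5 1 3 0 \<in> H" using tr[of 3 4 0] e34 e40 by simp
  have e41: "addrow_mat 5 1 4 1 \<in> H" using tr[of 4 0 1] e40 e01 by simp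
  have e03: "addrow_mat 5 1 0 3 \<in> H" using tr[of 0 2 3] e02 e23 by simp
  have e14: "addrow_mat 5 1 1 4 \<in> H" using tr[of 1 3 4] e13 e34 by simp
  have e20: "addrow_mat 5 1 2 0 \<in> H" using tr[of 2 4 0] e24 e40 by simp
  have e31: "addrow_mat 5 1 3 1 \<in> H" using tr[of 3 0 1] e30 e01 by simp
  have e42: "addrow_mat 5 1 4 2 \<in> H" using tr[of 4 1 2] e41 e12 by simp
  have e04: "addrow_mat 5 1 0 4 \<in> H" using tr[of 0 3 4] e03 e34 by simp
  have e10: "addrow_mat 5 1 1 0 \<in> H" using tr[of 1 4 0] e14 e40 by simp
  have e21: "addrow_mat 5 1 2 1 \<in> H" using tr[of 2 0 1] e20 e01 by simp
  have e32: "addrow_mat 5 1 3 2 \<in> H" using tr[of 3 1 2] e31 e12 by simp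
  have e43: "addrow_mat 5 1 4 3 \<in> H" using tr[of 4 2 3] e42 e23 by simp
  have "k \<in> {0, 1, 2, 3, 4}" "l \<in> {0, 1, 2, 3, 4}" using kl by auto
  then show ?thesis
    using kl(3) e01 e02 e03 e04 e10 e12 e13 e14 e20 e21 e23 e24 e30 e31 e32 e34 e40 e41 e42 e43
    by auto
qed

lemma generating_set_M10_t12: "generating_set (ESL 5) {M10, t12}"
proof -
  interpret group "ESL 5" by (rule group_ESL)
  let ?H = "generate (ESL 5) {M10, t12}"
  have S: "{M10, t12} \<subseteq> carrier (ESL 5)"
    using M10_in_ESL addrow_mat_in_ESL[of 0 5 1 1] by (simp add: t12_eq)
  have H: "subgroup ?H (ESL 5)" using generate_is_subgroup[OF S] .
  have M: "M10 \<in> ?H" and t: "t12 \<in> ?H" by (auto intro: generate.incl)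
  note special = det_one_in_subgroup_if_elementary[OF H elementary_in_subgroup[OF H M t]]
  note mult = subgroup.m_closed[OF H, simplified]
  have neg: "- 1\<^sub>m 5 \<in> ?H"
    unfolding M10_pow5[symmetric] by (intro mult M)
  have "A \<in> ?H" if A: "A \<in> carrier (ESL 5)" for A
  proof (cases "det A = 1")
    case True
    then show ?thesis using special A by (auto simp: carrier_ESL_iff)
  next
    case False
    have Ac: "A \<in> carrier_mat 5 5" using A by (simp add: carrier_ESL_iff)
    then have eq: "- 1\<^sub>m 5 * A = - A" by simp
    have "det (- A) = 1"
      using A False by (auto simp: uminus_mat_eq_smult carrier_ESL_iff)
    then have "- 1\<^sub>m 5 * A \<in> ?H" using special[of "- A"] Ac eq by simp
    then show ?thesis using subgroup_cancel_left[OF H neg A] by blast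
  qed
  then show ?thesis
    unfolding generating_set_def using S generate_incl[OF S] by blast
qed

section \<open>One generator does not suffice\<close>

lemma (in group) generate_singleton_commute:
  assumes "T \<subseteq> {x}" "x \<in> carrier G" "a \<in> generate G T" "b \<in> generate G T"
  shows "a \<otimes> b = b \<otimes> a"
proof -
  have "a \<in> generate G {x}" "b \<in> generate G {x}"
    using assms mono_generate[of T "{x}"] by auto
  then obtain k l :: int where "a = x [^] k" "b = x [^] l"
    using generate_pow[OF assms(2)] by auto
  then show ?thesis
    using assms(2) by (simp flip: int_pow_mult add: add.commute)
qed

lemma M10_t12_noncommuting: "M10 * t12 \<noteq> t12 * M10"
proof -
  have "(M10 * t12) $$ (1, 1) = 1"
    by (subst M10_mult) (simp_all add: t12_eq)
  moreover have "t12 * M10 = addrow 1 0 1 M10"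
    using addrow_mat[OF M10_carrier, of 1 1 0] by (simp add: t12_eq)
  then have "(t12 * M10) $$ (1, 1) = 0"
    by (simp add: M10_eq)
  ultimately show ?thesis by force
qed

theorem lemma2p1: "minimal_generating_set (ESL 5) {M10, t12}"
proof -
  interpret group "ESL 5" by (rule group_ESL)
  have False if T: "generating_set (ESL 5) T" "T \<prec> {M10, t12}" for T
  proof -
    have "{M10, t12} \<approx> {..<card {M10, t12}}"
      by (simp add: eqpoll_iff_finite_card)
    then have "T \<prec> {..<card {M10, t12}}"
      using T(2) by (metis lesspoll_eq_trans)
    then have "finite T" "card T < card {M10, t12}"
      by (auto simp: lesspoll_iff_finite_card)
    then have "finite T" "card T \<le> 1"
      using card_insert_le_m1[of 2 "{t12}" M10] by (auto simp: card_insert_if split: if_splits)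
    then consider "T = {}" | x where "T = {x}"
      by (metis card_0_eq card_1_singletonE le_SucE le_zero_eq One_nat_def)
    then obtain x where x: "T \<subseteq> {x}" "x \<in> carrier (ESL 5)"
      using T(1) one_closed by cases (auto simp: generating_set_def)
    have "M10 \<in> generate (ESL 5) T" "t12 \<in> generate (ESL 5) T"
      using T(1) generating_set_M10_t12 by (auto simp: generating_set_def)
    then show False
      using generate_singleton_commute[OF x] M10_t12_noncommuting by simp
  qed
  then show ?thesis
    using generating_set_M10_t12 by (auto simp: minimal_generating_set_def)
qed

end
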